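(* Let income be uniformly distributed on $[0,1]$, let $0<d<\rho<1$, and let $\{y_t\}_{t\ge0}$ be the optimal repayment sequence, with limit $\bar x$. With $\Pi_k$ the NPV of a type-$k$ consumer, let $k^*=\min\{k\ge 0:\Pi_k\ge 0\}$. Then unprofitable consumers are exactly those who default in periods $k=0,1,\dots,k^*-1$; profitable (non-creditworthy) consumers are exactly those who default in some period $k\ge k^*$; and creditworthy consumers never default. Further, with the cutoff value $\theta^*=y_{k^*-1}$, (i) the consumer is unprofitable for $\theta\in[0,\theta^* )$; (ii) the consumer is profitable but non-creditworthy for $\theta\in[\theta^*,\bar x)$; (iii) the consumer is creditworthy for $\theta\ge\bar x$. Moreover, for all $k\ge k^*$, $\Pi_{k+1}\ge \Pi_k$.
   Context: Exogenous-rate lending problem. A consumer has a fixed income $\theta\sim F$, unknown to the lender. In each period $t=0,1,\dots$ in which the relationship is still active, the lender chooses a repayment amount $y_t\ge0$ and lends $d\,y_t$ ($d$ fixed). At the end of the period the consumer repays $y_t$ if $\theta\ge y_t$; otherwise she repays nothing (default) and the relationship ends. The lender discounts at $\rho$ and maximizes $$\Pi(\mathbf y)=\sum_{t=0}^\infty \rho^t\Big[\prod_{i=0}^{t-1}\mathbb P(\theta\ge y_i\mid \mathcal H_i)\Big]\big[\rho\,\mathbb P(\theta\ge y_t\mid\mathcal H_t)\,y_t-d\,y_t\big],$$ where $\mathcal H_t$ is the event $\theta\ge\max_{i<t}y_i$ (no information at $t=0$) and the empty product is $1$. The optimal sequence is unique, strictly increasing, and for $F$ uniform on $[0,1]$ converges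 to $\bar x=\frac{\rho-d}{2\rho-d-d\rho}$. Set $y_{-1}=0$. A consumer with $\theta\in[y_{k-1},y_k)$, $k=0,1,2,\dots$, is of type $k$: she repays in periods $0,\dots,k-1$ and defaults in period $k$. Her NPV to the lender is $$\Pi_k=\sum_{i=0}^{k-1}\rho^i(\rho-d)y_i-\rho^k d\,y_k .$$ A consumer with $\theta\ge\bar x$ is called creditworthy. A type-$k$ consumer (finite $k$) is unprofitable if $\Pi_k<0$ and profitable (non-creditworthy) if $\Pi_k\ge0$. *)

theory Defs
  imports "HOL-Probability.Probability"
begin

text \<open>Throughout, \<open>M\<close> is the probability space carrying the consumer's income \<open>\<theta>\<close>, \<open>\<rho>\<close> is the
  discount factor, \<open>d\<close> the exogenous loan-to-repayment ratio, and \<open>y t\<close> the repayment amount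
  demanded in period \<open>t\<close>.\<close>

text \<open>\<open>P(\<theta> \<ge> y\<^sub>t | H\<^sub>t)\<close>. The history event \<open>\<theta> \<ge> max\<^bsub>i<t\<^esub> y\<^sub>i\<close> is written pointwise, so that it is
  the whole space for \<open>t = 0\<close>. If \<open>H\<^sub>t\<close> is a null event, the library's convention makes this 0;
  the convention is immaterial below, since then the survival factor of period \<open>t\<close> is 0.\<close>

definition repay_prob :: "'w measure \<Rightarrow> ('w \<Rightarrow> real) \<Rightarrow> (nat \<Rightarrow> real) \<Rightarrow> nat \<Rightarrow> real" where
  "repay_prob M \<theta> y t = cond_prob M (\<lambda>\<omega>. \<theta> \<omega> \<ge> y t) (\<lambda>\<omega>. \<forall>i<t. \<theta> \<omega> \<ge> y i)"

definition lender_profit ::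
    "'w measure \<Rightarrow> ('w \<Rightarrow> real) \<Rightarrow> real \<Rightarrow> real \<Rightarrow> (nat \<Rightarrow> real) \<Rightarrow> real" where
  "lender_profit M \<theta> \<rho> d y =
     (\<Sum>t. \<rho> ^ t * (\<Prod>i<t. repay_prob M \<theta> y i) * (\<rho> * repay_prob M \<theta> y t * y t - d * y t))"

text \<open>For income with bounded support and \<open>0 < \<rho> < 1\<close> the series converges absolutely for every
  nonnegative \<open>y\<close>: once some \<open>y t\<close> exceeds the support, all later survival factors vanish. Hence no
  summability side condition is needed when plans are compared under a uniform income.\<close>

definition optimal_repayment ::
    "'w measure \<Rightarrow> ('w \<Rightarrow> real) \<Rightarrow> real \<Rightarrow> real \<Rightarrow> (nat \<Rightarrow> real) \<Rightarrow> bool" where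
  "optimal_repayment M \<theta> \<rho> d y \<longleftrightarrow>
     (\<forall>t. 0 \<le> y t) \<and>
     (\<forall>z. (\<forall>t. 0 \<le> z t) \<longrightarrow> lender_profit M \<theta> \<rho> d z \<le> lender_profit M \<theta> \<rho> d y)"

definition xbar :: "real \<Rightarrow> real \<Rightarrow> real" where
  "xbar \<rho> d = (\<rho> - d) / (2 * \<rho> - d - d * \<rho>)"

text \<open>\<open>prev_repay y k\<close> is \<open>y\<^bsub>k-1\<^esub>\<close>, with \<open>y\<^bsub>-1\<^esub> = 0\<close>.\<close>

definition prev_repay :: "(nat \<Rightarrow> real) \<Rightarrow> nat \<Rightarrow> real" where
  "prev_repay y k = (case k of 0 \<Rightarrow> 0 | Suc j \<Rightarrow> y j)"

text \<open>From here on a consumer is identified with her realised income \<open>x\<close>.\<close>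

definition is_type :: "(nat \<Rightarrow> real) \<Rightarrow> nat \<Rightarrow> real \<Rightarrow> bool" where
  "is_type y k x \<longleftrightarrow> x \<in> {prev_repay y k..<y k}"

definition defaults_in :: "(nat \<Rightarrow> real) \<Rightarrow> nat \<Rightarrow> real \<Rightarrow> bool" where
  "defaults_in y k x \<longleftrightarrow> (\<forall>i<k. x \<ge> y i) \<and> x < y k"

definition never_defaults :: "(nat \<Rightarrow> real) \<Rightarrow> real \<Rightarrow> bool" where
  "never_defaults y x \<longleftrightarrow> (\<forall>t. x \<ge> y t)"

definition NPV :: "real \<Rightarrow> real \<Rightarrow> (nat \<Rightarrow> real) \<Rightarrow> nat \<Rightarrow> real" where
  "NPV \<rho> d y k = (\<Sum>i<k. \<rho> ^ i * (\<rho> - d) * y i) - \<rho> ^ k * d * y k"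

definition creditworthy :: "real \<Rightarrow> real \<Rightarrow> real \<Rightarrow> bool" where
  "creditworthy \<rho> d x \<longleftrightarrow> x \<ge> xbar \<rho> d"

definition unprofitable :: "real \<Rightarrow> real \<Rightarrow> (nat \<Rightarrow> real) \<Rightarrow> real \<Rightarrow> bool" where
  "unprofitable \<rho> d y x \<longleftrightarrow> (\<exists>k. is_type y k x \<and> NPV \<rho> d y k < 0)"

text \<open>Having a finite type is part of the definition; it is what excludes creditworthy consumers.\<close>

definition profitable :: "real \<Rightarrow> real \<Rightarrow> (nat \<Rightarrow> real) \<Rightarrow> real \<Rightarrow> bool" where
  "profitable \<rho> d y x \<longleftrightarrow> (\<exists>k. is_type y k x \<and> NPV \<rho> d y k \<ge> 0)"

end

theory Submission
  imports Defs
begin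

text \<open>
  The optimum is explicit: the Euler equation
  \<open>\<rho> d y\<^bsub>t+1\<^esub> - 2 \<rho> y\<^sub>t + d y\<^bsub>t-1\<^esub> + \<rho> - d = 0\<close> with \<open>y\<^bsub>-1\<^esub> = 0\<close> has the bounded solution
  \<open>y\<^sub>t = xbar (1 - \<lambda>\<^bsup>t+1\<^esup>)\<close>, where \<open>\<lambda> \<in> (0, 1)\<close> is the small characteristic root. Replacing an
  arbitrary plan by its running maximum, capped at 1, does not lower the profit, and on such
  plans the profit is a strictly concave quadratic; so every optimal plan has the explicit plan
  as its capped running maximum, and since the latter is strictly increasing and below 1 the two
  agree. Finally
  \<open>\<Pi>\<^bsub>k+1\<^esub> - \<Pi>\<^sub>k = \<rho>\<^bsup>k+1\<^esup> (y\<^sub>k - d y\<^bsub>k+1\<^esub>)\<close>, whose second factor increases in \<open>k\<close>: once the NPV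
  has increased, it never decreases again.
\<close>

text \<open>The maximum runs over the periods before \<open>t\<close>, matching the history event.
  Starting from 0 loses nothing, since income in \<open>{0..1}\<close> passes the threshold 0
  anyway.\<close>

primrec run_max :: "(nat \<Rightarrow> real) \<Rightarrow> nat \<Rightarrow> real" where
  "run_max z 0 = 0"
| "run_max z (Suc t) = max (run_max z t) (z t)"

lemma run_max_nonneg: "0 \<le> run_max z t"
  by (induction t) auto

lemma run_max_le_iff: "run_max z t \<le> x \<longleftrightarrow> 0 \<le> x \<and> (\<forall>i<t. z i \<le> x)"
  by (induction t) (auto simp: less_Suc_eq)

lemma run_max_Suc_mono:
  assumes "u 0 = 0" "mono u"
  shows "run_max (\<lambda>t. u (Suc t)) t = u t"
  by (induction t) (use assms in \<open>auto simp: max_def mono_def intro: antisym\<close>)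

section \<open>Lender profit under uniform income\<close>

context prob_space
begin

text \<open>The theorem's density divides by \<open>measure lborel {0..1}\<close> for an interval whose type is
  independent of that of the income; only the total mass of the density shows that this constant is 1.\<close>

lemma distributed_unit_uniform:
  fixes \<theta> :: "'a \<Rightarrow> real"
  assumes "distributed M lborel \<theta> (\<lambda>x. ennreal (indicator {0..1} x / c))"
  shows "distributed M lborel \<theta> (indicator {0..1})"
proof -
  have eq: "(\<lambda>x. ennreal (indicator {0..1::real} x / c)) = (\<lambda>x. ennreal (1 / c) * indicator {0..1} x)"
    by (auto split: split_indicator)
  have "\<theta> -` UNIV \<inter> space M = space M" by auto
  then have "1 = (\<integral>\<^sup>+x. ennreal (1 / c) * indicator {0..1::real} x \<partial>lborel)"
    using distributed_emeasure[OF assms[unfolded eq], of UNIV] emeasure_space_1 by simp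
  also have "\<dots> = ennreal (1 / c)"
    by (subst nn_integral_cmult_indicator) auto
  finally have "ennreal (1 / c) = 1" ..
  then show ?thesis
    using assms[unfolded eq] by simp
qed

lemma prob_unit_uniform:
  fixes \<theta> :: "'a \<Rightarrow> real"
  assumes "distributed M lborel \<theta> (indicator {0..1})"
    and "A \<in> sets borel"
  shows "\<P>(\<omega> in M. \<theta> \<omega> \<in> A) = measure lborel ({0..1} \<inter> A)"
proof -
  have "emeasure M (\<theta> -` A \<inter> space M) = (\<integral>\<^sup>+x. indicator {0..1} x * indicator A x \<partial>lborel)"
    using distributed_emeasure[OF assms(1)] assms(2) by simp
  also have "\<dots> = (\<integral>\<^sup>+x. indicator ({0..1} \<inter> A) x \<partial>lborel)"
    by (intro nn_integral_cong) (auto split: split_indicator)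
  also have "\<dots> = emeasure lborel ({0..1} \<inter> A)"
    using assms(2) by (intro nn_integral_indicator) (simp add: sets.Int)
  finally have "measure M (\<theta> -` A \<inter> space M) = measure lborel ({0..1} \<inter> A)"
    by (simp add: measure_def)
  moreover have "\<theta> -` A \<inter> space M = {\<omega> \<in> space M. \<theta> \<omega> \<in> A}"
    by auto
  ultimately show ?thesis by simp
qed

lemma prob_repaid_before:
  fixes \<theta> :: "'a \<Rightarrow> real"
  assumes "distributed M lborel \<theta> (indicator {0..1})"
  shows "\<P>(\<omega> in M. \<forall>i<t. \<theta> \<omega> \<ge> z i) = 1 - min 1 (run_max z t)"
proof -
  have "{x. \<forall>i<t. x \<ge> z i} = (\<Inter>i<t. {z i..})" by auto
  then have "{x. \<forall>i<t. x \<ge> z i} \<in> sets borel"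
    by (cases "t = 0") auto
  from prob_unit_uniform[OF assms this]
  have "\<P>(\<omega> in M. \<forall>i<t. \<theta> \<omega> \<ge> z i) = measure lborel ({0..1} \<inter> {x. \<forall>i<t. x \<ge> z i})"
    by simp
  also have "{0..1} \<inter> {x. \<forall>i<t. x \<ge> z i} = {run_max z t..1}"
    by (auto simp: run_max_le_iff)
  also have "measure lborel {run_max z t..1} = 1 - min 1 (run_max z t)"
    by (cases "run_max z t \<le> 1") auto
  finally show ?thesis .
qed

text \<open>Each factor is a ratio of successive survival probabilities, so the product
  telescopes.\<close>

lemma prod_repay_prob:
  "(\<Prod>i<t. repay_prob M \<theta> y i) = \<P>(\<omega> in M. \<forall>i<t. \<theta> \<omega> \<ge> y i)"
  if [measurable]: "\<theta> \<in> borel_measurable M"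
proof (induction t)
  case 0
  then show ?case by (simp add: prob_space)
next
  case (Suc t)
  define p where "p = \<P>(\<omega> in M. \<forall>i<t. \<theta> \<omega> \<ge> y i)"
  define q where "q = \<P>(\<omega> in M. \<forall>i<Suc t. \<theta> \<omega> \<ge> y i)"
  have "0 \<le> q" "q \<le> p"
    unfolding p_def q_def by (auto intro!: finite_measure_mono)
  \<comment> \<open>\<open>p = 0\<close> forces \<open>q = 0\<close>, so division by zero does no
    harm.\<close>
  then have "p * (q / p) = q"
    by (cases "p = 0") auto
  moreover have "{\<omega> \<in> space M. y t \<le> \<theta> \<omega> \<and> (\<forall>i<t. y i \<le> \<theta> \<omega>)} = {\<omega> \<in> space M. \<forall>i<Suc t. y i \<le> \<theta> \<omega>}"
    by (auto simp: less_Suc_eq)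
  then have "repay_prob M \<theta> y t = q / p"
    by (simp add: repay_prob_def cond_prob_def p_def q_def)
  ultimately show ?case
    by (simp add: Suc p_def q_def)
qed

lemma lender_profit_uniform:
  fixes \<theta> :: "'a \<Rightarrow> real"
  assumes "distributed M lborel \<theta> (indicator {0..1})"
  shows "lender_profit M \<theta> \<rho> d z =
    (\<Sum>t. \<rho> ^ t * (z t * (\<rho> * (1 - min 1 (run_max z (Suc t))) - d * (1 - min 1 (run_max z t)))))"
proof -
  have m: "\<theta> \<in> borel_measurable M"
    using distributed_measurable[OF assms] by simp
  have P: "(\<Prod>i<t. repay_prob M \<theta> z i) = 1 - min 1 (run_max z t)" for t
    using prod_repay_prob[OF m, of z t] prob_repaid_before[OF assms, of t z] by simp
  have step: "1 - min 1 (run_max z (Suc t)) = (1 - min 1 (run_max z t)) * repay_prob M \<theta> z t" for t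
    using P[of t] P[of "Suc t"] by simp
  show ?thesis
    unfolding lender_profit_def P step by (simp add: algebra_simps)
qed

end

text \<open>Period \<open>t\<close>'s profit from a nondecreasing plan in \<open>[0, 1]\<close> whose repayment in period \<open>t\<close> is
  \<open>w (Suc t)\<close>; the shift makes room for \<open>y\<^bsub>-1\<^esub> = w 0\<close>.\<close>

definition flow :: "real \<Rightarrow> real \<Rightarrow> (nat \<Rightarrow> real) \<Rightarrow> nat \<Rightarrow> real" where
  "flow \<rho> d w t = \<rho> ^ t * (w (Suc t) * (\<rho> * (1 - w (Suc t)) - d * (1 - w t)))"

section \<open>Domination by capped running maxima, and strict concavity\<close>

locale lending =
  fixes \<rho> d :: real
  assumes d_pos: "0 < d" and d_less: "d < \<rho>" and \<rho>_less: "\<rho> < 1"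
begin

lemma \<rho>_pos: "0 < \<rho>"
  using d_pos d_less by linarith

lemma profit_bracket_bound:
  assumes "0 \<le> a" "a \<le> 1" "0 \<le> b" "b \<le> 1"
  shows "\<bar>\<rho> * (1 - a) - d * (1 - b)\<bar> \<le> 1"
proof -
  have "0 \<le> \<rho> * (1 - a)" "\<rho> * (1 - a) \<le> 1" "0 \<le> d * (1 - b)" "d * (1 - b) \<le> 1"
    using assms d_pos d_less \<rho>_less by (auto intro: mult_le_one)
  then show ?thesis by linarith
qed

lemma summable_discounted:
  assumes "\<And>t. \<bar>f t\<bar> \<le> 1"
  shows "summable (\<lambda>t. \<rho> ^ t * f t)"
proof (rule summable_comparison_test)
  show "\<exists>N. \<forall>n\<ge>N. norm (\<rho> ^ n * f n) \<le> \<rho> ^ n"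
    using \<rho>_pos assms by (auto simp: abs_mult intro!: exI[of _ 0] mult_left_le)
  show "summable (\<lambda>n. \<rho> ^ n)"
    using \<rho>_pos \<rho>_less by (intro summable_geometric) auto
qed

lemma summable_flow:
  assumes "\<And>t. 0 \<le> w t" "\<And>t. w t \<le> 1"
  shows "summable (flow \<rho> d w)"
  unfolding flow_def
  by (intro summable_discounted)
     (use assms in \<open>auto simp: abs_mult intro!: mult_le_one profit_bracket_bound\<close>)

text \<open>Survival is the same on both sides. A demand below the running maximum causes no new
  default, so raising it earns the margin \<open>\<rho> - d\<close>; a demand above 1 is repaid with
  probability 0, so lowering it to 1 saves loan costs.\<close>

lemma profit_term_le_flow:
  "\<rho> ^ t * (z t * (\<rho> * (1 - min 1 (run_max z (Suc t))) - d * (1 - min 1 (run_max z t))))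
    \<le> flow \<rho> d (\<lambda>t. min 1 (run_max z t)) t"
proof -
  define r where "r = run_max z t"
  consider "1 \<le> r" | "r < 1" "z t \<le> r" | "r < z t" "z t \<le> 1" | "r < 1" "1 < z t"
    by linarith
  then have "z t * (\<rho> * (1 - min 1 (max r (z t))) - d * (1 - min 1 r))
    \<le> min 1 (max r (z t)) * (\<rho> * (1 - min 1 (max r (z t))) - d * (1 - min 1 r))"
  proof cases
    case 2
    have "z t * ((\<rho> - d) * (1 - r)) \<le> r * ((\<rho> - d) * (1 - r))"
      using 2 d_less by (intro mult_right_mono) auto
    with 2 show ?thesis by (simp add: algebra_simps)
  next
    case 4
    have "1 * (d * (1 - r)) \<le> z t * (d * (1 - r))"
      using 4 d_pos by (intro mult_right_mono) auto
    with 4 show ?thesis by simp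
  qed auto
  then show ?thesis
    unfolding flow_def r_def run_max.simps
    by (rule mult_left_mono) (use \<rho>_pos in simp)
qed

lemma summable_profit:
  assumes "\<And>t. 0 \<le> z t"
  shows "summable (\<lambda>t. \<rho> ^ t *
    (z t * (\<rho> * (1 - min 1 (run_max z (Suc t))) - d * (1 - min 1 (run_max z t)))))"
proof (cases "\<forall>t. z t \<le> 1")
  case True
  then show ?thesis
    using assms run_max_nonneg[of z]
    by (intro summable_discounted)
       (auto simp: abs_mult simp del: run_max.simps intro!: mult_le_one profit_bracket_bound)
next
  case False
  then obtain s where s: "1 < z s" by (auto simp: not_le)
  \<comment> \<open>After a demand above 1 the survival factors vanish, so only finitely many terms
    are nonzero.\<close>
  have "1 < run_max z t" if "s < t" for t
  proof -
    have "z s \<le> run_max z t"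
      using that run_max_le_iff[of z t "run_max z t"] by auto
    with s show ?thesis by linarith
  qed
  then show ?thesis
    by (intro summable_finite[of "{..s}"]) (auto simp del: run_max.simps simp: not_le less_Suc_eq)
qed

text \<open>The Euler equation makes the part linear in \<open>h\<close> telescope, and by AM-GM
  \<open>d h\<^sub>t h\<^bsub>t+1\<^esub>\<close> is at most a telescoping term plus less than the available curvature \<open>\<rho> h\<^bsub>t+1\<^esub>\<^sup>2\<close>.\<close>

lemma flow_diff_le:
  fixes u w :: "nat \<Rightarrow> real"
  assumes euler: "\<rho> - d - 2 * \<rho> * u (Suc t) + d * u t + \<rho> * d * u (Suc (Suc t)) = 0"
  defines "h \<equiv> \<lambda>t. w t - u t"
  defines "A \<equiv> \<lambda>t. \<rho> ^ t * (d * u (Suc t) * h t + d / 2 * (h t)\<^sup>2)"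
  shows "flow \<rho> d w t - flow \<rho> d u t
    \<le> A t - A (Suc t) - (\<rho> - d / 2 - \<rho> * d / 2) * (\<rho> ^ t * (h (Suc t))\<^sup>2)"
proof -
  define a b x y where "a = u t" and "b = u (Suc t)" and "x = h t" and "y = h (Suc t)"
  have w: "w t = a + x" "w (Suc t) = b + y"
    by (auto simp: a_def b_def x_def y_def h_def)
  have e: "\<rho> * (d * u (Suc (Suc t))) = 2 * \<rho> * b - d * a - \<rho> + d"
    using euler by (simp add: a_def b_def algebra_simps)
  \<comment> \<open>The slack in the bound is a square plus \<open>y\<close> times the Euler
    residual, which \<open>e\<close> makes vanish.\<close>
  have id: "A t - A (Suc t) - (\<rho> - d / 2 - \<rho> * d / 2) * (\<rho> ^ t * y\<^sup>2)
      - (flow \<rho> d w t - flow \<rho> d u t)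
    = \<rho> ^ t * (d / 2 * (x - y)\<^sup>2 + (2 * \<rho> * b - d * a - \<rho> + d - \<rho> * (d * u (Suc (Suc t)))) * y)"
    unfolding A_def flow_def w a_def[symmetric] b_def[symmetric] x_def[symmetric] y_def[symmetric]
    by (simp add: field_simps power2_eq_square)
  have "0 \<le> \<rho> ^ t * (d / 2 * (x - y)\<^sup>2)"
    using \<rho>_pos d_pos by simp
  with id e show ?thesis
    by (simp add: y_def)
qed

text \<open>When \<open>flow_diff_le\<close> is summed, the telescoping part drops out: it starts at
  0 because \<open>w 0 = u 0\<close> and tends to 0 by discounting. What remains is a negative
  multiple of the discounted squared deviations, so any deviation makes \<open>w\<close> strictly
  worse.\<close>

lemma maximal_flow_unique:
  assumes euler: "\<And>t. \<rho> - d - 2 * \<rho> * u (Suc t) + d * u t + \<rho> * d * u (Suc (Suc t)) = 0"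
    and u: "\<And>t. 0 \<le> u t" "\<And>t. u t \<le> 1" and w: "\<And>t. 0 \<le> w t" "\<And>t. w t \<le> 1"
    and start: "w 0 = u 0"
    and max: "(\<Sum>t. flow \<rho> d u t) \<le> (\<Sum>t. flow \<rho> d w t)"
  shows "w s = u s"
proof (rule ccontr)
  assume ne: "w s \<noteq> u s"
  define h where "h = (\<lambda>t. w t - u t)"
  define A where "A = (\<lambda>t. \<rho> ^ t * (d * u (Suc t) * h t + d / 2 * (h t)\<^sup>2))"
  define c where "c = \<rho> - d / 2 - \<rho> * d / 2"
  have "\<rho> * d < d" "d < \<rho>"
    using d_less \<rho>_less d_pos by auto
  then have c: "0 < c" by (simp add: c_def)
  have h: "\<bar>h t\<bar> \<le> 1" for t
    using u[of t] w[of t] by (auto simp: h_def)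
  have sh: "summable (\<lambda>t. \<rho> ^ t * (h (Suc t))\<^sup>2)"
    by (intro summable_discounted) (use h in \<open>simp add: abs_square_le_1\<close>)
  \<comment> \<open>Halving turns the bound 2 into the bound 1 required by
    \<open>summable_discounted\<close>.\<close>
  have "\<bar>(d * u (Suc t) * h t + d / 2 * (h t)\<^sup>2) / 2\<bar> \<le> 1" for t
  proof -
    have "\<bar>d * u (Suc t) * h t\<bar> \<le> 1"
      unfolding abs_mult using d_pos d_less \<rho>_less u h
      by (intro mult_le_one) auto
    moreover have "\<bar>d / 2 * (h t)\<^sup>2\<bar> \<le> 1"
      unfolding abs_mult using d_pos d_less \<rho>_less h
      by (intro mult_le_one) (auto simp: abs_square_le_1)
    ultimately have "\<bar>d * u (Suc t) * h t + d / 2 * (h t)\<^sup>2\<bar> \<le> 1 + 1"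
      by (intro order_trans[OF abs_triangle_ineq add_mono])
    then show ?thesis by simp
  qed
  then have "summable (\<lambda>t. 2 * (\<rho> ^ t * ((d * u (Suc t) * h t + d / 2 * (h t)\<^sup>2) / 2)))"
    by (intro summable_mult summable_discounted)
  then have "A \<longlonglongrightarrow> 0"
    by (intro summable_LIMSEQ_zero) (simp add: A_def)
  then have "(\<lambda>t. A t - A (Suc t)) sums (A 0 - 0)"
    by (rule telescope_sums')
  moreover have "A 0 = 0"
    by (simp add: A_def h_def start)
  ultimately have A: "(\<lambda>t. A t - A (Suc t)) sums 0" by simp
  have su: "summable (flow \<rho> d u)" and sw: "summable (flow \<rho> d w)"
    using u w by (auto intro: summable_flow)
  have le: "flow \<rho> d w t - flow \<rho> d u t \<le> A t - A (Suc t) - c * (\<rho> ^ t * (h (Suc t))\<^sup>2)" for t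
    using flow_diff_le[where u = u and w = w, OF euler] unfolding A_def h_def c_def .
  have flow_sums: "(\<lambda>t. flow \<rho> d w t - flow \<rho> d u t) sums
      ((\<Sum>t. flow \<rho> d w t) - (\<Sum>t. flow \<rho> d u t))"
    using su sw by (intro sums_diff summable_sums)
  have A_sums: "(\<lambda>t. A t - A (Suc t) - c * (\<rho> ^ t * (h (Suc t))\<^sup>2)) sums
      (0 - c * (\<Sum>t. \<rho> ^ t * (h (Suc t))\<^sup>2))"
    using A sh by (intro sums_diff sums_mult summable_sums)
  have "c * (\<Sum>t. \<rho> ^ t * (h (Suc t))\<^sup>2) \<le> 0"
    using sums_le[OF le flow_sums A_sums] max by linarith
  moreover have "0 < (\<Sum>t. \<rho> ^ t * (h (Suc t))\<^sup>2)"
  proof -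
    \<comment> \<open>The sum sees \<open>h\<close> only from index 1 on; a deviation at index 0 is
      excluded by \<open>start\<close>.\<close>
    obtain s' where "s = Suc s'"
      using ne start by (cases s) auto
    then show ?thesis
      using ne \<rho>_pos sh by (intro suminf_pos2[of _ s']) (auto simp: h_def)
  qed
  ultimately show False
    using mult_pos_pos[OF c] by force
qed

section \<open>The explicit optimal plan\<close>

lemma small_root: "\<exists>l. 0 < l \<and> l < 1 \<and> \<rho> * d * l\<^sup>2 - 2 * \<rho> * l + d = 0"
proof -
  have "\<rho> * d < \<rho>"
    using \<rho>_pos d_less \<rho>_less by simp
  then have neg: "\<rho> * d - 2 * \<rho> + d < 0"
    using d_less by simp
  \<comment> \<open>The quadratic equals \<open>d > 0\<close> at 0 and is negative at 1 by
    \<open>neg\<close>.\<close>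
  have "\<exists>l\<ge>0. l \<le> 1 \<and> \<rho> * d * l\<^sup>2 - 2 * \<rho> * l + d = 0"
    using neg d_pos by (intro IVT2') (auto intro!: continuous_intros)
  then obtain l where l: "0 \<le> l" "l \<le> 1" and root: "\<rho> * d * l\<^sup>2 - 2 * \<rho> * l + d = 0"
    by auto
  from root neg d_pos have "l \<noteq> 0" "l \<noteq> 1" by auto
  with l root show ?thesis
    by (intro exI[of _ l]) auto
qed

lemma xbar_denominator_pos: "0 < 2 * \<rho> - d - d * \<rho>"
proof -
  have "d * \<rho> < 1 * \<rho>"
    using \<rho>_pos d_less \<rho>_less by (intro mult_strict_right_mono) auto
  then show ?thesis using d_less by simp
qed

lemma xbar_pos: "0 < xbar \<rho> d"
  using xbar_denominator_pos d_less by (simp add: xbar_def)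

lemma xbar_less_1: "xbar \<rho> d < 1"
proof -
  have "d * \<rho> < 1 * \<rho>"
    using \<rho>_pos d_less \<rho>_less by (intro mult_strict_right_mono) auto
  then show ?thesis
    using xbar_denominator_pos by (simp add: xbar_def)
qed

text \<open>A sandwich: the flow total of the explicit plan is its profit, hence at most the profit
  of \<open>y\<close> by optimality, hence at most the flow total of the capped running maximum of
  \<open>y\<close>. Uniqueness then identifies the two flows' plans.\<close>

lemma optimal_repayment_uniform:
  fixes \<theta> :: "'w \<Rightarrow> real"
  assumes "prob_space M"
    and unif: "distributed M lborel \<theta> (indicator {0..1})"
    and opt: "optimal_repayment M \<theta> \<rho> d y"
    and l: "0 < l" "l < 1" and root: "\<rho> * d * l\<^sup>2 - 2 * \<rho> * l + d = 0"
  shows "y t = xbar \<rho> d * (1 - l ^ Suc t)"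
proof -
  interpret prob_space M by fact
  define u where "u = (\<lambda>t. xbar \<rho> d * (1 - l ^ t))"
  define w where "w = (\<lambda>t. min 1 (run_max y t))"
  have pow: "0 < l ^ t" "l ^ Suc t < l ^ t" for t
    using l by (auto simp: power_strict_decreasing)
  have u: "0 \<le> u t" "u t < 1" for t
  proof -
    show "0 \<le> u t"
      using xbar_pos l by (simp add: u_def power_le_one)
    have "u t \<le> xbar \<rho> d"
      using xbar_pos pow(1)[of t] by (simp add: u_def mult_left_le)
    then show "u t < 1" using xbar_less_1 by linarith
  qed
  have inc: "u t < u (Suc t)" for t
    unfolding u_def using xbar_pos pow(2)[of t] by (intro mult_strict_left_mono) auto
  have "mono u"
    using inc by (simp add: incseq_SucI less_imp_le)
  then have rm: "run_max (\<lambda>t. u (Suc t)) t = u t" for t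
    by (intro run_max_Suc_mono) (auto simp: u_def)
  have y0: "0 \<le> y t" for t
    using opt by (simp add: optimal_repayment_def)
  have w: "0 \<le> w t" "w t \<le> 1" for t
    by (auto simp: w_def run_max_nonneg)
  have euler: "\<rho> - d - 2 * \<rho> * u (Suc t) + d * u t + \<rho> * d * u (Suc (Suc t)) = 0" for t
  proof -
    have X: "xbar \<rho> d * (2 * \<rho> - d - d * \<rho>) = \<rho> - d"
      using xbar_denominator_pos by (simp add: xbar_def)
    \<comment> \<open>The residual splits into a constant part, killed by the value of
      \<open>xbar\<close>, and a multiple of \<open>l ^ t\<close>, killed by the characteristic
      equation.\<close>
    have "\<rho> - d - 2 * \<rho> * u (Suc t) + d * u t + \<rho> * d * u (Suc (Suc t))
      = \<rho> - d - xbar \<rho> d * (2 * \<rho> - d - d * \<rho>)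
        - xbar \<rho> d * l ^ t * (\<rho> * d * l\<^sup>2 - 2 * \<rho> * l + d)"
      by (simp add: u_def algebra_simps power2_eq_square)
    then show ?thesis by (simp add: X root)
  qed
  have "(\<Sum>t. flow \<rho> d u t) = lender_profit M \<theta> \<rho> d (\<lambda>t. u (Suc t))"
    unfolding lender_profit_uniform[OF unif] rm flow_def using u by (simp add: less_imp_le)
  also have "\<dots> \<le> lender_profit M \<theta> \<rho> d y"
    using opt u by (simp add: optimal_repayment_def)
  also have "\<dots> \<le> (\<Sum>t. flow \<rho> d w t)"
    unfolding lender_profit_uniform[OF unif] w_def using y0
    by (intro suminf_le profit_term_le_flow summable_profit summable_flow)
       (auto simp: run_max_nonneg)
  finally have le: "(\<Sum>t. flow \<rho> d u t) \<le> (\<Sum>t. flow \<rho> d w t)" .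
  have "w 0 = u 0"
    by (simp add: w_def u_def)
  then have weq: "w t = u t" for t
    by (rule maximal_flow_unique[where u = u and w = w, OF euler u(1) less_imp_le[OF u(2)] w _ le])
  \<comment> \<open>As \<open>u\<close> stays below 1, the cap never binds; as \<open>u\<close>
    increases strictly, each \<open>y t\<close> must itself set the new maximum.\<close>
  have rmy: "run_max y t = u t" for t
    using weq[of t] u(2)[of t] unfolding w_def by linarith
  then have "max (u t) (y t) = u (Suc t)"
    using rmy[of t] rmy[of "Suc t"] by simp
  then have "y t = u (Suc t)"
    using inc[of t] by linarith
  then show ?thesis
    unfolding u_def .
qed

text \<open>Defaulting one period later adds the repayment \<open>y k\<close>, received at the end
  of period \<open>k\<close>, and the cost of one more loan \<open>d * y (Suc k)\<close>, both
  discounted by \<open>\<rho> ^ Suc k\<close>.\<close>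

lemma NPV_Suc_diff: "NPV \<rho> d y (Suc k) - NPV \<rho> d y k = \<rho> ^ Suc k * (y k - d * y (Suc k))"
  by (simp add: NPV_def algebra_simps)

end

theorem proposition3p3:
  fixes M :: "'w measure" and \<theta> :: "'w \<Rightarrow> real"
    and \<rho> d :: real and y :: "nat \<Rightarrow> real" and kstar :: nat
  assumes "prob_space M"
    and "distributed M lborel \<theta> (\<lambda>x. indicator {0..1} x / measure lborel {0..1})"
    and "0 < d" and "d < \<rho>" and "\<rho> < 1"
    and "optimal_repayment M \<theta> \<rho> d y"
    and "kstar = (LEAST k. NPV \<rho> d y k \<ge> 0)"
  shows "y \<longlonglongrightarrow> xbar \<rho> d
    \<and> (\<exists>k. NPV \<rho> d y k \<ge> 0)
    \<and> (\<forall>x\<ge>0. unprofitable \<rho> d y x \<longleftrightarrow> (\<exists>k<kstar. defaults_in y k x))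
    \<and> (\<forall>x\<ge>0. profitable \<rho> d y x \<and> \<not> creditworthy \<rho> d x \<longleftrightarrow> (\<exists>k\<ge>kstar. defaults_in y k x))
    \<and> (\<forall>x\<ge>0. creditworthy \<rho> d x \<longrightarrow> never_defaults y x)
    \<and> (\<forall>x\<in>{0..<prev_repay y kstar}. unprofitable \<rho> d y x)
    \<and> (\<forall>x\<in>{prev_repay y kstar..<xbar \<rho> d}. profitable \<rho> d y x \<and> \<not> creditworthy \<rho> d x)
    \<and> (\<forall>x\<ge>xbar \<rho> d. creditworthy \<rho> d x)
    \<and> (\<forall>k\<ge>kstar. NPV \<rho> d y (Suc k) \<ge> NPV \<rho> d y k)"
proof -
  interpret lending \<rho> d
    by unfold_locales fact+
  obtain l where l: "0 < l" "l < 1" and root: "\<rho> * d * l\<^sup>2 - 2 * \<rho> * l + d = 0"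
    using small_root by blast
  have y: "y t = xbar \<rho> d * (1 - l ^ Suc t)" for t
    using optimal_repayment_uniform[OF assms(1) prob_space.distributed_unit_uniform[OF assms(1,2)] assms(6) l root] .
  have pow: "0 < l ^ t" "l ^ Suc t < l ^ t" for t
    using l by (auto simp: power_strict_decreasing)
  have inc: "y t < y (Suc t)" for t
    unfolding y using xbar_pos pow(2)[of "Suc t"] by (intro mult_strict_left_mono) auto
  then have smono: "strict_mono y"
    by (rule strict_mono_Suc_iff[THEN iffD2, rule_format])
  have below: "y t < xbar \<rho> d" for t
    using xbar_pos pow(1)[of "Suc t"] by (simp add: y del: power_Suc)
  have ypos: "0 < y t" for t
    using xbar_pos l by (simp add: y power_less_one_iff del: power_Suc)
  have "(\<lambda>t. xbar \<rho> d * (1 - l ^ Suc t)) \<longlonglongrightarrow> xbar \<rho> d * (1 - 0)"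
    using l by (intro tendsto_intros LIMSEQ_Suc LIMSEQ_power_zero) auto
  then have lim: "y \<longlonglongrightarrow> xbar \<rho> d"
    by (simp add: y[abs_def] del: power_Suc)

  have gap: "y j - d * y (Suc j) \<le> y k - d * y (Suc k)" if "j \<le> k" for j k
  proof -
    \<comment> \<open>In closed form only \<open>l ^ Suc i\<close> depends on the period, and it
      shrinks.\<close>
    have "y i - d * y (Suc i) = xbar \<rho> d * (1 - d - l ^ Suc i * (1 - d * l))" for i
      by (simp add: y algebra_simps)
    moreover have "l ^ Suc k * (1 - d * l) \<le> l ^ Suc j * (1 - d * l)"
    proof (rule mult_right_mono)
      show "l ^ Suc k \<le> l ^ Suc j"
        using that l by (intro power_decreasing) auto
      have "d * l \<le> 1"
        using l d_pos d_less \<rho>_less by (intro mult_le_one) auto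
      then show "0 \<le> 1 - d * l" by simp
    qed
    ultimately show ?thesis
      using xbar_pos by simp
  qed

  \<comment> \<open>The cutoff period\<close>
  have ex: "\<exists>k. NPV \<rho> d y k \<ge> 0"
  proof -
    \<comment> \<open>For \<open>k \<ge> 1\<close> the NPV is at least the margin earned in period 0
      minus the default loss, and the latter tends to 0.\<close>
    have "(\<lambda>k. (\<rho> - d) * y 0 - \<rho> ^ k * d * y k) \<longlonglongrightarrow> (\<rho> - d) * y 0 - 0 * d * xbar \<rho> d"
      using \<rho>_pos \<rho>_less by (intro tendsto_intros LIMSEQ_power_zero lim) auto
    moreover have "0 < (\<rho> - d) * y 0 - 0 * d * xbar \<rho> d"
      using ypos[of 0] d_less by simp
    ultimately have "eventually (\<lambda>k. 0 < (\<rho> - d) * y 0 - \<rho> ^ k * d * y k) sequentially"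
      by (rule order_tendstoD)
    from eventually_conj[OF this eventually_ge_at_top[of 1]]
    obtain k where k: "0 < (\<rho> - d) * y 0 - \<rho> ^ k * d * y k" "1 \<le> k"
      by (auto simp: eventually_sequentially)
    have "(\<Sum>i\<in>{0}. \<rho> ^ i * (\<rho> - d) * y i) \<le> (\<Sum>i<k. \<rho> ^ i * (\<rho> - d) * y i)"
      using k(2) d_less \<rho>_pos ypos by (intro sum_mono2) (auto simp: less_imp_le)
    with k(1) show ?thesis
      by (intro exI[of _ k]) (simp add: NPV_def)
  qed
  have kstar: "NPV \<rho> d y kstar \<ge> 0"
    unfolding assms(7) using ex by (rule LeastI_ex)
  have before: "NPV \<rho> d y k < 0" if "k < kstar" for k
    using not_less_Least[of k "\<lambda>k. NPV \<rho> d y k \<ge> 0"] that assms(7) by simp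
  \<comment> \<open>Type 0 only costs the first loan, so the cutoff is some \<open>Suc j\<close>.
    The NPV changes sign from \<open>j\<close> to \<open>Suc j\<close>, which makes the increment
    there positive.\<close>
  have "NPV \<rho> d y 0 < 0"
    using ypos[of 0] d_pos by (simp add: NPV_def)
  with kstar obtain j where j: "kstar = Suc j"
    by (cases kstar) auto
  have "NPV \<rho> d y j < 0" "0 \<le> NPV \<rho> d y (Suc j)"
    using before kstar j by auto
  then have "0 < \<rho> ^ Suc j * (y j - d * y (Suc j))"
    unfolding NPV_Suc_diff[symmetric] by linarith
  then have gap_j: "0 < y j - d * y (Suc j)"
    by (rule zero_less_mult_pos) (use \<rho>_pos in simp)
  have grow: "NPV \<rho> d y k \<le> NPV \<rho> d y (Suc k)" if "kstar \<le> k" for k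
  proof -
    have "0 \<le> \<rho> ^ Suc k * (y k - d * y (Suc k))"
      using gap[of j k] gap_j that j \<rho>_pos by (intro mult_nonneg_nonneg) auto
    then show ?thesis
      using NPV_Suc_diff[of y k] by simp
  qed
  have after: "0 \<le> NPV \<rho> d y k" if "kstar \<le> k" for k
    using that
  proof (induction rule: dec_induct)
    case (step n)
    then show ?case
      using grow[of n] by linarith
  qed (rule kstar)
  have neg_iff: "NPV \<rho> d y k < 0 \<longleftrightarrow> k < kstar" for k
    using before after by (metis not_le)

  \<comment> \<open>Classification of incomes\<close>
  have type_iff: "is_type y k x \<longleftrightarrow> defaults_in y k x" if "0 \<le> x" for k x
  proof (cases k)
    case 0
    with that show ?thesis
      by (simp add: is_type_def defaults_in_def prev_repay_def)
  next
    case (Suc i)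
    \<comment> \<open>Demands increase, so meeting the latest one means having met all earlier
      ones.\<close>
    have "(\<forall>n<Suc i. y n \<le> x) \<longleftrightarrow> y i \<le> x"
    proof (intro iffI allI impI)
      fix n
      assume "y i \<le> x" "n < Suc i"
      moreover from this(2) have "y n \<le> y i"
        using smono by (simp add: strict_mono_less_eq)
      ultimately show "y n \<le> x" by linarith
    qed simp
    with Suc show ?thesis
      by (simp add: is_type_def defaults_in_def prev_repay_def)
  qed
  have type_ex: "\<exists>k. defaults_in y k x" if "x < y n" for x n
  proof -
    \<comment> \<open>Default occurs in the first period whose demand exceeds income.\<close>
    have "x < y (LEAST n. x < y n)"
      using that by (rule LeastI)
    moreover have "y i \<le> x" if "i < (LEAST n. x < y n)" for i
      using not_less_Least[OF that] by simp
    ultimately show ?thesis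
      by (auto simp: defaults_in_def)
  qed
  have unprof: "unprofitable \<rho> d y x \<longleftrightarrow> (\<exists>k<kstar. defaults_in y k x)" if "0 \<le> x" for x
    using type_iff[OF that] neg_iff by (auto simp: unprofitable_def)
  have prof: "profitable \<rho> d y x \<and> \<not> creditworthy \<rho> d x \<longleftrightarrow> (\<exists>k\<ge>kstar. defaults_in y k x)"
    if "0 \<le> x" for x
  proof -
    have "profitable \<rho> d y x \<longleftrightarrow> (\<exists>k\<ge>kstar. defaults_in y k x)"
      using type_iff[OF that] neg_iff by (metis profitable_def not_less)
    \<comment> \<open>A defaulter's income is below some \<open>y k\<close>, hence below
      \<open>xbar\<close>.\<close>
    moreover have "\<not> creditworthy \<rho> d x" if "defaults_in y k x" for k
      using that below[of k] by (simp add: defaults_in_def creditworthy_def)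
    ultimately show ?thesis by blast
  qed
  have low: "unprofitable \<rho> d y x" if "0 \<le> x" "x < prev_repay y kstar" for x
  proof -
    have "x < y j"
      using that(2) by (simp add: j prev_repay_def)
    then obtain k where k: "defaults_in y k x"
      using type_ex by blast
    \<comment> \<open>Surviving past period \<open>j\<close> would require income of at least
      \<open>y j\<close>.\<close>
    have "\<not> j < k"
      using k \<open>x < y j\<close> unfolding defaults_in_def by (meson not_le)
    then have "k < kstar"
      by (simp add: j)
    with k unprof[OF that(1)] show ?thesis by blast
  qed
  have middle: "profitable \<rho> d y x" "\<not> creditworthy \<rho> d x"
    if lower: "prev_repay y kstar \<le> x" and upper: "x < xbar \<rho> d" for x
  proof -
    have x: "y j \<le> x"
      using lower by (simp add: j prev_repay_def)
    \<comment> \<open>Income below the limit of the demands is exceeded by some demand.\<close>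
    obtain n where "x < y n"
      using order_tendstoD(1)[OF lim upper] by (auto simp: eventually_sequentially)
    then obtain k where k: "defaults_in y k x"
      using type_ex by blast
    then have "y j < y k"
      using x by (simp add: defaults_in_def)
    then have "kstar \<le> k"
      using smono j by (simp add: strict_mono_less Suc_le_eq)
    moreover have "0 \<le> x"
      using x ypos[of j] by linarith
    ultimately show "profitable \<rho> d y x" "\<not> creditworthy \<rho> d x"
      using k prof by blast+
  qed
  have never: "never_defaults y x" if "creditworthy \<rho> d x" for x
    unfolding never_defaults_def
  proof
    show "y t \<le> x" for t
      using that below[of t] by (simp add: creditworthy_def)
  qed
  show ?thesis
    by (intro conjI allI ballI impI lim ex unprof prof never low middle grow)
      (auto simp: creditworthy_def)
qed

end
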